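(* Let $\ell_h(u,y)=\max\{0,1-uy\}$ be the hinge loss. There exist universal constants $c,c',c''>0$ such that if $0<\lambda\leq \frac{1}{4}$ and the positive integers $m,B$ satisfy $B < \frac{c}{\lambda^2} \le c' m^2$, then for any budgeted algorithm with budget $B$ there exist an $m\times m$ kernel matrix $K$ and target values $y=(y_1,\dots,y_m)$ in $\{-1,+1\}$ such that the coefficient vector $\boldsymbol{\alpha}$ returned by the algorithm satisfies \[ \Delta_{\ell_h}(m,\boldsymbol{\alpha},K,\lambda,y)\;\ge\; c''~. \]
   Context: For a loss $\ell$, an $m\times m$ kernel matrix $K$ (symmetric positive semidefinite), a vector $\boldsymbol{\alpha}\in\mathbb{R}^m$, targets $y=(y_1,\dots,y_m)$ and $\lambda>0$, with $\boldsymbol{e}_1,\dots,\boldsymbol{e}_m$ the standard basis of $\mathbb{R}^m$, \[ \Delta_\ell(m,\boldsymbol{\alpha},K,\lambda,y)=\left(\frac{1}{m}\sum_{t=1}^{m}\ell\left(\boldsymbol{\alpha}^\top K \boldsymbol{e}_t,y_t\right)+\frac{\lambda}{2}\boldsymbol{\alpha}^\top K \boldsymbol{\alpha}\right) - \min_{\boldsymbol{a}\in\mathbb{R}^m}\left(\frac{1}{m}\sum_{t=1}^{m}\ell\left(\boldsymbol{a}^\top K \boldsymbol{e}_t,y_t\right)+\frac{\lambda}{2}\boldsymbol{a}^\top K \boldsymbol{a}\right). \] Budgeted algorithm: the algorithm is given the target values $y_1,\dots,y_m$ but not the kernel matrix $K$. It may (adaptively) query at most $B$ entries of $K$, and then returns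 a coefficient vector $\boldsymbol{\alpha}\in\mathbb{R}^m$ based on this information. If the algorithm is randomized, $\Delta_\ell$ of the returned vector is understood in expectation over the algorithm's internal randomness. *)

theory Defs
  imports "HOL-Probability.Probability" "Jordan_Normal_Form.Matrix"
begin

no_notation vec_nth (infixl \<open>$\<close> 90)
no_notation inner (infix \<open>\<bullet>\<close> 70)

definition kernel_matrix :: "nat \<Rightarrow> real mat \<Rightarrow> bool" where
  "kernel_matrix m K \<longleftrightarrow>
     K \<in> carrier_mat m m \<and> K\<^sup>T = K \<and> (\<forall>a\<in>carrier_vec m. 0 \<le> a \<bullet> (K *\<^sub>v a))"

definition hinge_loss :: "real \<Rightarrow> real \<Rightarrow> real" where
  "hinge_loss u y = max 0 (1 - u * y)"

definition objective ::
  "(real \<Rightarrow> real \<Rightarrow> real) \<Rightarrow> nat \<Rightarrow> real mat \<Rightarrow> real \<Rightarrow> real vec \<Rightarrow> real vec \<Rightarrow> real" where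
  "objective l m K lam y a =
     1 / real m * (\<Sum>t<m. l (a \<bullet> (K *\<^sub>v unit_vec m t)) (y $ t)) + lam / 2 * (a \<bullet> (K *\<^sub>v a))"

text \<open>
  The minimum over all coefficient vectors is written as an infimum of reals. Whenever the minimum
  is attained the two agree (see \<open>Delta_eq_minimum\<close> below); for a convex nonnegative loss such as
  the hinge loss, a kernel matrix and a positive regularization parameter it always is.
\<close>
definition Delta ::
  "(real \<Rightarrow> real \<Rightarrow> real) \<Rightarrow> nat \<Rightarrow> real vec \<Rightarrow> real mat \<Rightarrow> real \<Rightarrow> real vec \<Rightarrow> real" where
  "Delta l m \<alpha> K lam y =
     objective l m K lam y \<alpha> - (INF a\<in>carrier_vec m. objective l m K lam y a)"

text \<open>
  An adaptive query strategy: either return a coefficient vector, or ask for the entry in row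
  \<open>i\<close> and column \<open>j\<close> (counted from 0) and continue depending on the value obtained.
\<close>
datatype strategy = Return "real vec" | Query nat nat "real \<Rightarrow> strategy"

primrec returned :: "real mat \<Rightarrow> strategy \<Rightarrow> real vec" where
  "returned K (Return a) = a"
| "returned K (Query i j f) = returned K (f (K $$ (i, j)))"

primrec queried :: "real mat \<Rightarrow> strategy \<Rightarrow> (nat \<times> nat) set" where
  "queried K (Return a) = {}"
| "queried K (Query i j f) = insert (i, j) (queried K (f (K $$ (i, j))))"

text \<open>
  A deterministic algorithm sees the targets from the start, so it maps them to a strategy; on every
  input it must look at no more than \<open>B\<close> entries of the kernel matrix.
\<close>
definition budgeted :: "nat \<Rightarrow> nat \<Rightarrow> (real vec \<Rightarrow> strategy) \<Rightarrow> bool" where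
  "budgeted m B A \<longleftrightarrow>
     (\<forall>K y. kernel_matrix m K \<longrightarrow> y \<in> carrier_vec m \<longrightarrow>
        queried K (A y) \<subseteq> {..<m} \<times> {..<m} \<and>
        card (queried K (A y)) \<le> B \<and>
        returned K (A y) \<in> carrier_vec m)"

text \<open>
  A randomized algorithm is a probability distribution over deterministic ones, such that on each
  input the returned vector is a random vector. Any other source of randomness can be pushed forward
  to this form, and a deterministic algorithm is a point mass. The sigma-algebra of \<open>P\<close> is
  arbitrary, so no measurable structure on algorithms is presupposed.
\<close>
definition randomized_budgeted :: "nat \<Rightarrow> nat \<Rightarrow> (real vec \<Rightarrow> strategy) measure \<Rightarrow> bool" where
  "randomized_budgeted m B P \<longleftrightarrow>
     prob_space P \<and> (\<forall>A\<in>space P. budgeted m B A) \<and>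
     (\<forall>K y. kernel_matrix m K \<longrightarrow> y \<in> carrier_vec m \<longrightarrow>
        (\<forall>i<m. (\<lambda>A. returned K (A y) $ i) \<in> borel_measurable P))"

text \<open>
  The expectation is a nonnegative integral, hence defined (possibly as infinity) without an
  integrability assumption. Nothing is truncated by \<^const>\<open>ennreal\<close>, see
  \<open>Delta_hinge_nonneg\<close>.
\<close>
definition expected_Delta ::
  "(real \<Rightarrow> real \<Rightarrow> real) \<Rightarrow> nat \<Rightarrow> (real vec \<Rightarrow> strategy) measure \<Rightarrow> real mat \<Rightarrow> real \<Rightarrow> real vec
     \<Rightarrow> ennreal" where
  "expected_Delta l m P K lam y = (\<integral>\<^sup>+ A. ennreal (Delta l m (returned K (A y)) K lam y) \<partial>P)"

lemma Delta_eq_minimum: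
  assumes "b \<in> carrier_vec m"
    and "\<And>a. a \<in> carrier_vec m \<Longrightarrow> objective l m K lam y b \<le> objective l m K lam y a"
  shows "Delta l m \<alpha> K lam y = objective l m K lam y \<alpha> - objective l m K lam y b"
proof -
  have "(INF a\<in>carrier_vec m. objective l m K lam y a) = objective l m K lam y b"
    using assms by (intro cInf_eq_minimum) auto
  then show ?thesis by (simp add: Delta_def)
qed

lemma objective_hinge_nonneg:
  assumes "kernel_matrix m K" "0 \<le> lam" "a \<in> carrier_vec m"
  shows "0 \<le> objective hinge_loss m K lam y a"
  using assms unfolding objective_def kernel_matrix_def hinge_loss_def
  by (intro add_nonneg_nonneg mult_nonneg_nonneg sum_nonneg) auto

lemma Delta_hinge_nonneg:
  assumes "kernel_matrix m K" "0 \<le> lam" "\<alpha> \<in> carrier_vec m"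
  shows "0 \<le> Delta hinge_loss m \<alpha> K lam y"
proof -
  have "bdd_below (objective hinge_loss m K lam y ` carrier_vec m)"
    using objective_hinge_nonneg[OF assms(1,2)] by (intro bdd_belowI2[where m = 0]) auto
  then show ?thesis
    unfolding Delta_def using assms(3) by (simp add: cINF_lower)
qed

lemma randomized_budgeted_return:
  assumes "budgeted m B A"
  shows "randomized_budgeted m B (return (count_space {A}) A)"
  using assms by (auto simp: randomized_budgeted_def intro!: prob_space_return measurableI)

lemma expected_Delta_return:
  "expected_Delta l m (return (count_space {A}) A) K lam y =
     ennreal (Delta l m (returned K (A y)) K lam y)"
  by (simp add: expected_Delta_def nn_integral_return)

end

theory Submission
  imports Defs
begin

text \<open>
  All targets are \<open>1\<close> and the kernel is the indicator of a partition into clusters, so the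
  objective only depends on the cluster sums of the coefficients, and its excess over the minimum is
  at least \<open>\<lambda>\<close> times the total deviation of these sums from \<open>1\<close>. The indices are first grouped
  publicly into about \<open>1 / \<lambda>\<close> residue classes of nearly equal size; the hidden partition merges
  the classes joined by a bipartite partial matching \<open>M\<close>. If the algorithm, run on \<open>M\<close>, does not
  look at a free pair \<open>e = (p, q)\<close>, then it returns the same coefficients on \<open>M\<close> and on
  \<open>insert e M\<close>. The coefficient sums \<open>a\<close>, \<open>b\<close> of \<open>p\<close>, \<open>q\<close> would have to be close to \<open>1\<close> for \<open>M\<close>,
  while \<open>a + b\<close> would have to be close to \<open>1\<close> for \<open>insert e M\<close>. Double counting the pairs
  \<open>(M, e)\<close> over the matchings of two consecutive sizes shows that some matching is bad on average.
\<close>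

section \<open>Kernels of partitions\<close>

text \<open>The Gram matrix of the one-hot vectors of the labels, hence positive semidefinite for
  every labelling \<open>h\<close>.\<close>

definition cluster_kernel :: "nat \<Rightarrow> (nat \<Rightarrow> 'b) \<Rightarrow> real mat" where
  "cluster_kernel m h = mat m m (\<lambda>(i, j). if h i = h j then 1 else 0)"

definition cluster_sum :: "nat \<Rightarrow> (nat \<Rightarrow> 'b) \<Rightarrow> real vec \<Rightarrow> 'b \<Rightarrow> real" where
  "cluster_sum m h a c = (\<Sum>t | t < m \<and> h t = c. a $ t)"

lemma cluster_kernel_carrier [simp]: "cluster_kernel m h \<in> carrier_mat m m"
  by (simp add: cluster_kernel_def)

lemma cluster_kernel_mult_vec:
  assumes "a \<in> carrier_vec m" "i < m"
  shows "(cluster_kernel m h *\<^sub>v a) $ i = cluster_sum m h a (h i)"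
proof -
  have "(cluster_kernel m h *\<^sub>v a) $ i = (\<Sum>j<m. (if h i = h j then 1 else 0) * a $ j)"
    using assms by (simp add: cluster_kernel_def scalar_prod_def atLeast0LessThan)
  also have "\<dots> = (\<Sum>j\<in>{..<m} \<inter> {j. h i = h j}. a $ j)"
    unfolding sum.inter_restrict[OF finite_lessThan] by (intro sum.cong) auto
  also have "{..<m} \<inter> {j. h i = h j} = {t. t < m \<and> h t = h i}"
    by auto
  finally show ?thesis by (simp add: cluster_sum_def)
qed

lemma cluster_kernel_prediction:
  assumes "a \<in> carrier_vec m" "t < m"
  shows "a \<bullet> (cluster_kernel m h *\<^sub>v unit_vec m t) = cluster_sum m h a (h t)"
proof -
  have "cluster_sum m h (unit_vec m t) (h i) = (if h i = h t then 1 else 0)" for i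
    unfolding cluster_sum_def using assms(2)
    by (subst sum.mono_neutral_right[where S = "{x. x = t \<and> h t = h i}"]) auto
  then have "a \<bullet> (cluster_kernel m h *\<^sub>v unit_vec m t)
      = (\<Sum>i<m. a $ i * (if h i = h t then 1 else 0))"
    using assms cluster_kernel_mult_vec[of "unit_vec m t" m _ h]
    by (simp add: scalar_prod_def atLeast0LessThan cluster_kernel_def)
  also have "\<dots> = (\<Sum>i\<in>{..<m} \<inter> {i. h i = h t}. a $ i)"
    unfolding sum.inter_restrict[OF finite_lessThan] by (intro sum.cong) auto
  also have "{..<m} \<inter> {i. h i = h t} = {i. i < m \<and> h i = h t}"
    by auto
  finally show ?thesis by (simp add: cluster_sum_def)
qed

lemma cluster_kernel_quadratic_form:
  assumes "a \<in> carrier_vec m"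
  shows "a \<bullet> (cluster_kernel m h *\<^sub>v a) = (\<Sum>c\<in>h ` {..<m}. (cluster_sum m h a c)\<^sup>2)"
proof -
  have "a \<bullet> (cluster_kernel m h *\<^sub>v a) = (\<Sum>i<m. a $ i * cluster_sum m h a (h i))"
    using assms cluster_kernel_mult_vec[OF assms, of _ h]
    by (simp add: scalar_prod_def atLeast0LessThan cluster_kernel_def)
  also have "\<dots> = (\<Sum>c\<in>h ` {..<m}. \<Sum>i | i \<in> {..<m} \<and> h i = c. a $ i * cluster_sum m h a (h i))"
    by (rule sum.image_gen) simp
  also have "\<dots> = (\<Sum>c\<in>h ` {..<m}. (cluster_sum m h a c)\<^sup>2)"
    by (intro sum.cong refl)
       (simp add: cluster_sum_def power2_eq_square sum_distrib_right)
  finally show ?thesis .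
qed

lemma kernel_matrix_cluster_kernel: "kernel_matrix m (cluster_kernel m h)"
proof -
  have "(cluster_kernel m h)\<^sup>T = cluster_kernel m h"
    by (rule eq_matI) (auto simp: cluster_kernel_def)
  then show ?thesis
    by (auto simp: kernel_matrix_def cluster_kernel_quadratic_form intro: sum_nonneg)
qed

text \<open>All indices of a cluster share one prediction, so the objective splits into independent
  one-dimensional problems, one per cluster.\<close>

lemma objective_cluster_kernel:
  assumes "a \<in> carrier_vec m"
  shows "objective hinge_loss m (cluster_kernel m h) lam (vec m (\<lambda>_. 1)) a =
    (\<Sum>c\<in>h ` {..<m}. real (card {t. t < m \<and> h t = c}) / real m * max 0 (1 - cluster_sum m h a c)
        + lam / 2 * (cluster_sum m h a c)\<^sup>2)"
proof -
  have "(\<Sum>t<m. hinge_loss (a \<bullet> (cluster_kernel m h *\<^sub>v unit_vec m t)) (vec m (\<lambda>_. 1) $ t))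
      = (\<Sum>t<m. max 0 (1 - cluster_sum m h a (h t)))"
    using assms by (intro sum.cong refl) (simp add: cluster_kernel_prediction hinge_loss_def)
  also have "\<dots> = (\<Sum>c\<in>h ` {..<m}. \<Sum>t | t \<in> {..<m} \<and> h t = c. max 0 (1 - cluster_sum m h a (h t)))"
    by (rule sum.image_gen) simp
  also have "\<dots> = (\<Sum>c\<in>h ` {..<m}.
      real (card {t. t < m \<and> h t = c}) * max 0 (1 - cluster_sum m h a c))"
    by (intro sum.cong refl) simp
  finally show ?thesis
    using assms
    by (simp add: objective_def cluster_kernel_quadratic_form sum.distrib sum_distrib_left
        sum_divide_distrib)
qed

text \<open>The right-hand side equals \<open>lam / 2\<close> at \<open>s = 1\<close>. Right of
  \<open>1\<close> the regularizer has slope \<open>lam * s\<close>, at least \<open>lam\<close>;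
  left of \<open>1\<close> the slope is \<open>lam * s - w\<close>, at most \<open>-lam\<close>
  because \<open>w\<close> is at least \<open>2 * lam\<close>.\<close>

lemma hinge_excess_ge:
  fixes w lam s :: real
  assumes "0 \<le> lam" "2 * lam \<le> w"
  shows "lam / 2 + lam * \<bar>s - 1\<bar> \<le> w * max 0 (1 - s) + lam / 2 * s\<^sup>2"
proof (cases "1 \<le> s")
  case True
  have "0 \<le> lam * (s - 1)\<^sup>2" using assms by simp
  with True show ?thesis by (simp add: max_def power2_eq_square algebra_simps)
next
  case False
  have "0 \<le> (w - 2 * lam) * (1 - s)" "0 \<le> lam * (1 - s)\<^sup>2" using assms False by simp_all
  with False show ?thesis by (simp add: max_def power2_eq_square algebra_simps)
qed

lemma Delta_cluster_kernel_ge: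
  assumes a: "a \<in> carrier_vec m" and "0 \<le> lam"
    and w: "\<And>c. c \<in> h ` {..<m} \<Longrightarrow> 2 * lam * real m \<le> real (card {t. t < m \<and> h t = c})"
  shows "lam * (\<Sum>c\<in>h ` {..<m}. \<bar>cluster_sum m h a c - 1\<bar>)
    \<le> Delta hinge_loss m a (cluster_kernel m h) lam (vec m (\<lambda>_. 1))"
proof -
  let ?obj = "objective hinge_loss m (cluster_kernel m h) lam (vec m (\<lambda>_. 1))"
  \<comment> \<open>Unit mass spread evenly over each cluster: every cluster sum is \<open>1\<close>
    and every hinge term vanishes. The objective of \<open>b\<close> bounds the infimum from
    above.\<close>
  define b where "b = vec m (\<lambda>t. 1 / real (card {u. u < m \<and> h u = h t}))"
  have b: "b \<in> carrier_vec m" by (simp add: b_def)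
  have sum_b: "cluster_sum m h b c = 1" if c: "c \<in> h ` {..<m}" for c
  proof -
    have "cluster_sum m h b c = (\<Sum>t | t < m \<and> h t = c. 1 / real (card {u. u < m \<and> h u = c}))"
      unfolding cluster_sum_def by (intro sum.cong refl) (auto simp: b_def)
    moreover have "card {u. u < m \<and> h u = c} \<noteq> 0" using c by (auto simp: card_eq_0_iff)
    ultimately show ?thesis by simp
  qed
  have "bdd_below (?obj ` carrier_vec m)"
    using objective_hinge_nonneg[OF kernel_matrix_cluster_kernel assms(2)]
    by (intro bdd_belowI2[where m = 0]) auto
  then have "(INF a\<in>carrier_vec m. ?obj a) \<le> ?obj b"
    using b by (rule cINF_lower)
  also have "\<dots> = (\<Sum>c\<in>h ` {..<m}. lam / 2)"
    by (simp add: objective_cluster_kernel[OF b] sum_b)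
  finally have "?obj a - (\<Sum>c\<in>h ` {..<m}. lam / 2)
      \<le> Delta hinge_loss m a (cluster_kernel m h) lam (vec m (\<lambda>_. 1))"
    by (simp add: Delta_def)
  moreover have "(\<Sum>c\<in>h ` {..<m}. lam / 2 + lam * \<bar>cluster_sum m h a c - 1\<bar>) \<le> ?obj a"
    unfolding objective_cluster_kernel[OF a]
  proof (intro sum_mono hinge_excess_ge assms(2))
    fix c assume c: "c \<in> h ` {..<m}"
    then have "0 < m" by auto
    with w[OF c] show "2 * lam \<le> real (card {t. t < m \<and> h t = c}) / real m"
      by (simp add: divide_simps)
  qed
  ultimately show ?thesis by (simp add: sum.distrib sum_distrib_left)
qed

section \<open>Partial matchings\<close>

definition matchings :: "'a set \<Rightarrow> 'b set \<Rightarrow> nat \<Rightarrow> ('a \<times> 'b) set set" where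
  "matchings L R r = {M. M \<subseteq> L \<times> R \<and> card M = r \<and> inj_on fst M \<and> inj_on snd M}"

text \<open>Exactly the pairs by which a matching \<open>M\<close> can be extended.\<close>

definition free_pairs :: "'a set \<Rightarrow> 'b set \<Rightarrow> ('a \<times> 'b) set \<Rightarrow> ('a \<times> 'b) set" where
  "free_pairs L R M = (L - fst ` M) \<times> (R - snd ` M)"

text \<open>With \<open>s\<close> the coefficient sums of the classes, this is the total distance of
  the cluster sums from \<open>1\<close>: an unmatched class is a cluster by itself, a matched pair
  forms one cluster.\<close>

definition matching_deviation :: "'a set \<Rightarrow> 'a set \<Rightarrow> ('a \<times> 'a) set \<Rightarrow> ('a \<Rightarrow> real) \<Rightarrow> real" where
  "matching_deviation L R M s = (\<Sum>p\<in>L - fst ` M. \<bar>s p - 1\<bar>) + (\<Sum>q\<in>R - snd ` M. \<bar>s q - 1\<bar>)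
    + (\<Sum>(p, q)\<in>M. \<bar>s p + s q - 1\<bar>)"

lemma finite_matchings: "finite L \<Longrightarrow> finite R \<Longrightarrow> finite (matchings L R r)"
  by (rule finite_subset[of _ "Pow (L \<times> R)"]) (auto simp: matchings_def)

lemma finite_matching: "finite L \<Longrightarrow> finite R \<Longrightarrow> M \<in> matchings L R r \<Longrightarrow> finite M"
  by (auto simp: matchings_def intro: finite_subset)

lemma card_unmatched:
  assumes "finite L" "finite R" "M \<in> matchings L R r"
  shows "card (L - fst ` M) = card L - r" "card (R - snd ` M) = card R - r"
proof -
  have "fst ` M \<subseteq> L" "snd ` M \<subseteq> R" "card (fst ` M) = r" "card (snd ` M) = r"
    using assms(3) by (auto simp: matchings_def card_image)
  with assms(1,2) show "card (L - fst ` M) = card L - r" "card (R - snd ` M) = card R - r"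
    by (metis card_Diff_subset finite_subset)+
qed

lemma card_free_pairs:
  assumes "finite L" "finite R" "M \<in> matchings L R r"
  shows "card (free_pairs L R M) = (card L - r) * (card R - r)"
  using card_unmatched[OF assms] by (simp add: free_pairs_def card_cartesian_product)

lemma matchings_nonempty:
  assumes "finite L" "finite R" "r \<le> card L" "r \<le> card R"
  shows "matchings L R r \<noteq> {}"
proof -
  obtain L' R' where sub: "L' \<subseteq> L" "card L' = r" "R' \<subseteq> R" "card R' = r"
    using assms by (meson obtain_subset_with_card_n)
  then have "finite L'" "finite R'" using assms finite_subset by auto
  then obtain f where f: "bij_betw f L' R'"
    using finite_same_card_bij sub by metis
  have "inj_on (\<lambda>x. (x, f x)) L'" by (auto simp: inj_on_def)
  then have "card ((\<lambda>x. (x, f x)) ` L') = r" using sub by (simp add: card_image)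
  then have "(\<lambda>x. (x, f x)) ` L' \<in> matchings L R r"
    using f sub by (auto simp: matchings_def bij_betw_def inj_on_def)
  then show ?thesis by blast
qed

text \<open>Deleting the marked edge undoes the insertion. This turns sums over extensions of
  smaller matchings into sums over the edges of larger ones.\<close>

lemma bij_betw_insert_free_pair:
  assumes fin: "finite L" "finite R"
  shows "bij_betw (\<lambda>(M, e). (insert e M, e))
    (SIGMA M:matchings L R r. free_pairs L R M) (SIGMA M:matchings L R (Suc r). M)"
proof (rule bij_betw_byWitness[where f' = "\<lambda>(M, e). (M - {e}, e)"])
  show "\<forall>x\<in>SIGMA M:matchings L R r. free_pairs L R M.
      (\<lambda>(M, e). (M - {e}, e)) ((\<lambda>(M, e). (insert e M, e)) x) = x"
    by (force simp: free_pairs_def)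
  show "\<forall>x\<in>SIGMA M:matchings L R (Suc r). M.
      (\<lambda>(M, e). (insert e M, e)) ((\<lambda>(M, e). (M - {e}, e)) x) = x"
    by auto
  show "(\<lambda>(M, e). (insert e M, e)) ` (SIGMA M:matchings L R r. free_pairs L R M)
      \<subseteq> (SIGMA M:matchings L R (Suc r). M)"
  proof clarsimp
    fix M p q assume M: "M \<in> matchings L R r" and e: "(p, q) \<in> free_pairs L R M"
    have "(p, q) \<notin> M" using e by (force simp: free_pairs_def)
    then have "card (insert (p, q) M) = Suc r"
      using M finite_matching[OF fin M] by (simp add: matchings_def)
    moreover have "inj_on fst (insert (p, q) M)" "inj_on snd (insert (p, q) M)"
      using M e by (auto simp: matchings_def free_pairs_def)
    ultimately show "insert (p, q) M \<in> matchings L R (Suc r)"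
      using M e by (auto simp: matchings_def free_pairs_def)
  qed
  show "(\<lambda>(M, e). (M - {e}, e)) ` (SIGMA M:matchings L R (Suc r). M)
      \<subseteq> (SIGMA M:matchings L R r. free_pairs L R M)"
  proof clarsimp
    fix M p q assume M: "M \<in> matchings L R (Suc r)" and e: "(p, q) \<in> M"
    have "card (M - {(p, q)}) = r" using M e finite_matching[OF fin M] by (simp add: matchings_def)
    moreover have "inj_on fst (M - {(p, q)})" "inj_on snd (M - {(p, q)})"
      using M by (auto simp: matchings_def intro: inj_on_subset)
    \<comment> \<open>No other edge shares an endpoint with \<open>(p, q)\<close>, so deleting it
      frees both endpoints.\<close>
    moreover have "fst ` (M - {(p, q)}) = fst ` M - {p}" "snd ` (M - {(p, q)}) = snd ` M - {q}"
      using M e inj_on_image_set_diff[of fst M M "{(p, q)}"] inj_on_image_set_diff[of snd M M "{(p, q)}"]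
      by (simp_all add: matchings_def)
    then have "(p, q) \<in> free_pairs L R (M - {(p, q)})"
      using M e by (auto simp: free_pairs_def matchings_def)
    ultimately show "M - {(p, q)} \<in> matchings L R r \<and> (p, q) \<in> free_pairs L R (M - {(p, q)})"
      using M by (auto simp: matchings_def)
  qed
qed

lemma card_matchings_Suc:
  assumes "finite L" "finite R"
  shows "card (matchings L R (Suc r)) * Suc r
    = card (matchings L R r) * ((card L - r) * (card R - r))"
proof -
  have "(\<Sum>M\<in>matchings L R r. card (free_pairs L R M)) = (\<Sum>M\<in>matchings L R (Suc r). card M)"
    using bij_betw_same_card[OF bij_betw_insert_free_pair[OF assms]] assms
      finite_matchings[OF assms] finite_matching[OF assms]
    by (subst (asm) (1 2) card_SigmaI) (auto simp: free_pairs_def)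
  moreover have "(\<Sum>M\<in>matchings L R (Suc r). card M) = (\<Sum>M\<in>matchings L R (Suc r). Suc r)"
    by (intro sum.cong) (auto simp: matchings_def)
  ultimately show ?thesis using assms by (simp add: card_free_pairs)
qed

text \<open>Each unmatched class lies in exactly \<open>n - r\<close> free pairs.\<close>

lemma sum_unmatched_le:
  assumes fin: "finite L" "finite R" and "card L = n" "card R = n" and M: "M \<in> matchings L R r"
  shows "(\<Sum>(p, q)\<in>free_pairs L R M. \<bar>s p - 1\<bar> + \<bar>s q - 1\<bar>)
    \<le> real (n - r) * matching_deviation L R M s"
proof -
  have "(\<Sum>(p, q)\<in>free_pairs L R M. \<bar>s p - 1\<bar> + \<bar>s q - 1\<bar>)
      = (\<Sum>p\<in>L - fst ` M. \<Sum>q\<in>R - snd ` M. \<bar>s p - 1\<bar> + \<bar>s q - 1\<bar>)"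
    by (simp add: free_pairs_def sum.cartesian_product)
  also have "\<dots> = real (n - r) * ((\<Sum>p\<in>L - fst ` M. \<bar>s p - 1\<bar>) + (\<Sum>q\<in>R - snd ` M. \<bar>s q - 1\<bar>))"
    using card_unmatched[OF fin M] assms(3,4)
    by (simp add: sum.distrib sum_distrib_left algebra_simps)
  also have "\<dots> \<le> real (n - r) * matching_deviation L R M s"
    unfolding matching_deviation_def by (intro mult_left_mono) (auto intro!: sum_nonneg)
  finally show ?thesis .
qed

text \<open>\<open>T M\<close> stands for the pairs probed on \<open>M\<close>. Each unprobed free
  pair \<open>e\<close> contributes at least \<open>1\<close>, charged partly to its endpoints in
  \<open>M\<close> and partly to the edge \<open>e\<close> of \<open>insert e M\<close>.\<close>

lemma matching_deviation_double_counting: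
  fixes s :: "('a \<times> 'a) set \<Rightarrow> 'a \<Rightarrow> real"
  assumes fin: "finite L" "finite R" and n: "card L = n" "card R = n"
    and T: "\<And>M. M \<in> matchings L R r \<Longrightarrow> finite (T M) \<and> card (T M) \<le> B"
    and same: "\<And>M e. M \<in> matchings L R r \<Longrightarrow> e \<in> free_pairs L R M - T M \<Longrightarrow> s (insert e M) = s M"
  shows "real (card (matchings L R r)) * (real (n - r) ^ 2 - real B)
    \<le> real (n - r) * (\<Sum>M\<in>matchings L R r. matching_deviation L R M (s M))
      + (\<Sum>M\<in>matchings L R (Suc r). matching_deviation L R M (s M))"
proof -
  define f where "f = (\<lambda>M (p, q). \<bar>s M p - 1\<bar> + \<bar>s M q - 1\<bar>)"
  define g where "g = (\<lambda>M (p, q). \<bar>s M p + s M q - 1\<bar>)"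
  have finF: "finite (free_pairs L R M)" for M using fin by (simp add: free_pairs_def)
  have nonneg: "0 \<le> f M e" "0 \<le> g M e" for M e by (auto simp: f_def g_def split: prod.split)
  have "real (card (matchings L R r)) * (real (n - r) ^ 2 - real B)
      = (\<Sum>M\<in>matchings L R r. real (card (free_pairs L R M)) - real B)"
    using fin n by (simp add: card_free_pairs power2_eq_square)
  also have "\<dots> \<le> (\<Sum>M\<in>matchings L R r. \<Sum>e\<in>free_pairs L R M. f M e + g (insert e M) e)"
  proof (rule sum_mono)
    fix M assume M: "M \<in> matchings L R r"
    have "real (card (free_pairs L R M)) - real B \<le> real (card (free_pairs L R M - T M))"
      using diff_card_le_card_Diff[of "T M" "free_pairs L R M"] T[OF M] by linarith
    also have "\<dots> = (\<Sum>e\<in>free_pairs L R M - T M. 1)" by simp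
    also have "\<dots> \<le> (\<Sum>e\<in>free_pairs L R M - T M. f M e + g (insert e M) e)"
    proof (rule sum_mono)
      fix e assume e: "e \<in> free_pairs L R M - T M"
      obtain p q where "e = (p, q)" by force
      \<comment> \<open>Triangle inequality for \<open>(a - 1) + (b - 1) - (a + b - 1) = -1\<close>,
        where \<open>a\<close> and \<open>b\<close> are the common values of \<open>s M\<close> and
        \<open>s (insert e M)\<close> at \<open>p\<close> and \<open>q\<close>.\<close>
      then show "1 \<le> f M e + g (insert e M) e"
        unfolding g_def same[OF M e] f_def by simp
    qed
    also have "\<dots> \<le> (\<Sum>e\<in>free_pairs L R M. f M e + g (insert e M) e)"
      using finF nonneg by (intro sum_mono2) auto
    finally show "real (card (free_pairs L R M)) - real B
      \<le> (\<Sum>e\<in>free_pairs L R M. f M e + g (insert e M) e)" .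
  qed
  also have "\<dots> = (\<Sum>M\<in>matchings L R r. \<Sum>e\<in>free_pairs L R M. f M e)
      + (\<Sum>M\<in>matchings L R r. \<Sum>e\<in>free_pairs L R M. g (insert e M) e)"
    by (simp add: sum.distrib)
  also have "(\<Sum>M\<in>matchings L R r. \<Sum>e\<in>free_pairs L R M. g (insert e M) e)
      = (\<Sum>(M, e)\<in>(SIGMA M:matchings L R r. free_pairs L R M). g (insert e M) e)"
    using finF finite_matchings[OF fin] by (intro sum.Sigma) auto
  \<comment> \<open>Each edge of a larger matching arises exactly once as the inserted one, so the
    charges to it add up to the matched part of its deviation, with factor one.\<close>
  also have "\<dots> = (\<Sum>(M, e)\<in>(SIGMA M:matchings L R (Suc r). M). g M e)"
    using sum.reindex_bij_betw[OF bij_betw_insert_free_pair[OF fin], of "\<lambda>(M, e). g M e"]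
    by (simp add: case_prod_beta)
  also have "\<dots> = (\<Sum>M\<in>matchings L R (Suc r). \<Sum>e\<in>M. g M e)"
    using finite_matching[OF fin] finite_matchings[OF fin] by (intro sum.Sigma[symmetric]) auto
  also have "\<dots> \<le> (\<Sum>M\<in>matchings L R (Suc r). matching_deviation L R M (s M))"
    unfolding g_def matching_deviation_def
    by (intro sum_mono) (auto intro!: add_nonneg_nonneg sum_nonneg)
  also have "(\<Sum>M\<in>matchings L R r. \<Sum>e\<in>free_pairs L R M. f M e)
      \<le> real (n - r) * (\<Sum>M\<in>matchings L R r. matching_deviation L R M (s M))"
    unfolding sum_distrib_left f_def using sum_unmatched_le[OF fin n] by (intro sum_mono) auto
  finally show ?thesis by simp
qed

section \<open>Clusters merged by a matching\<close>

text \<open>Indices with equal residue modulo \<open>k\<close> always share a cluster; a matched right class is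
  labelled by its left partner.\<close>

definition matched_rep :: "(nat \<times> nat) set \<Rightarrow> nat \<Rightarrow> nat" where
  "matched_rep M x = (if x \<in> snd ` M then fst (inv_into M snd x) else x)"

definition residue_sum :: "nat \<Rightarrow> nat \<Rightarrow> real vec \<Rightarrow> nat \<Rightarrow> real" where
  "residue_sum m k = cluster_sum m (\<lambda>t. t mod k)"

definition matching_kernel :: "nat \<Rightarrow> nat \<Rightarrow> (nat \<times> nat) set \<Rightarrow> real mat" where
  "matching_kernel m k M = cluster_kernel m (\<lambda>t. matched_rep M (t mod k))"

lemma matched_rep_eq: "inj_on snd M \<Longrightarrow> (p, q) \<in> M \<Longrightarrow> matched_rep M q = p"
  using inv_into_f_f[of snd M "(p, q)"] by (force simp: matched_rep_def)

lemma matched_rep_unmatched: "x \<notin> snd ` M \<Longrightarrow> matched_rep M x = x"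
  by (simp add: matched_rep_def)

lemma card_residue_class_ge:
  fixes c k m :: nat
  assumes "c < k"
  shows "m div k \<le> card {t. t < m \<and> t mod k = c}"
proof -
  have "(\<lambda>j. j * k + c) ` {..<m div k} \<subseteq> {t. t < m \<and> t mod k = c}"
  proof clarsimp
    fix j assume "j < m div k"
    then have "Suc j * k \<le> m div k * k" by (intro mult_le_mono1) simp
    also have "\<dots> \<le> m" by simp
    finally show "j * k + c < m \<and> c mod k = c" using assms by simp
  qed
  moreover have "inj_on (\<lambda>j. j * k + c) {..<m div k}" using assms by (auto simp: inj_on_def)
  ultimately show ?thesis
    using card_mono[of "{t. t < m \<and> t mod k = c}" "(\<lambda>j. j * k + c) ` {..<m div k}"]
    by (simp add: card_image)
qed


lemma matched_rep_left:
  assumes "M \<in> matchings L R r" "L \<inter> R = {}" "x \<in> L"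
  shows "matched_rep M x = x"
  using assms by (intro matched_rep_unmatched) (force simp: matchings_def)

text \<open>A relabelled class gets the label of a matched left class, which \<open>c\<close> is
  not.\<close>

lemma matched_rep_fibre_free:
  assumes M: "M \<in> matchings L R r" and "L \<inter> R = {}" and c: "c \<in> (L - fst ` M) \<union> (R - snd ` M)"
  shows "{x \<in> L \<union> R. matched_rep M x = c} = {c}"
proof -
  have "x = c" if x: "x \<in> L \<union> R" "matched_rep M x = c" for x
  proof (cases "x \<in> snd ` M")
    case True
    then obtain p where p: "(p, x) \<in> M" by force
    then have "c = p" using x M matched_rep_eq[of M p x] by (simp add: matchings_def)
    moreover have "p \<in> L" "p \<in> fst ` M" using p M by (force simp: matchings_def)+
    ultimately show ?thesis using c assms(2) by blast
  qed (use x matched_rep_unmatched[of x M] in simp)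
  moreover have "matched_rep M c = c"
    using c matched_rep_left[OF assms(1,2)] matched_rep_unmatched[of c M] by blast
  ultimately show ?thesis using c by auto
qed

text \<open>Injectivity of \<open>fst\<close> on \<open>M\<close> rules out a second right class
  with label \<open>p\<close>.\<close>

lemma matched_rep_fibre_matched:
  assumes M: "M \<in> matchings L R r" and "L \<inter> R = {}" and pq: "(p, q) \<in> M"
  shows "{x \<in> L \<union> R. matched_rep M x = p} = {p, q}"
proof -
  have p: "p \<in> L" and q: "q \<in> R" using pq M by (auto simp: matchings_def)
  have "x = p \<or> x = q" if x: "x \<in> L \<union> R" "matched_rep M x = p" for x
  proof (cases "x \<in> snd ` M")
    case True
    then obtain p' where p': "(p', x) \<in> M" by force
    then have "p' = p" using x M matched_rep_eq[of M p' x] by (simp add: matchings_def)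
    then show ?thesis using p' pq M inj_onD[of fst M "(p, x)" "(p, q)"] by (simp add: matchings_def)
  qed (use x matched_rep_unmatched[of x M] in simp)
  moreover have "matched_rep M p = p" using matched_rep_left[OF assms(1,2) p] .
  moreover have "matched_rep M q = p" using matched_rep_eq[of M p q] pq M by (simp add: matchings_def)
  ultimately show ?thesis using p q by auto
qed

text \<open>Every label is itself a class carrying that label, so each cluster contains a full
  residue class. This bounds the cluster sizes from below.\<close>

lemma matched_rep_idem:
  assumes M: "M \<in> matchings L R r" and "L \<inter> R = {}" and x: "x \<in> L \<union> R"
  shows "matched_rep M x \<in> L \<union> R" "matched_rep M (matched_rep M x) = matched_rep M x"
proof -
  have "matched_rep M x \<in> L \<union> R \<and> matched_rep M (matched_rep M x) = matched_rep M x"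
  proof (cases "x \<in> snd ` M")
    case True
    then obtain p where p: "(p, x) \<in> M" by force
    then have "matched_rep M x = p" "p \<in> L"
      using M matched_rep_eq[of M p x] by (auto simp: matchings_def)
    then show ?thesis using matched_rep_left[OF assms(1,2)] by simp
  qed (use x matched_rep_unmatched[of x M] in simp)
  then show "matched_rep M x \<in> L \<union> R" "matched_rep M (matched_rep M x) = matched_rep M x"
    by auto
qed

lemma matched_rep_insert:
  assumes M: "insert (p, q) M \<in> matchings L R r" and "(p, q) \<notin> M"
  shows "matched_rep (insert (p, q) M) = (matched_rep M)(q := p)"
proof
  fix x
  have inj: "inj_on snd (insert (p, q) M)" using M by (simp add: matchings_def)
  then have inj': "inj_on snd M" by (auto intro: inj_on_subset)
  consider "x = q" | "x \<noteq> q" "x \<in> snd ` M" | "x \<noteq> q" "x \<notin> snd ` M" by blast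
  then show "matched_rep (insert (p, q) M) x = ((matched_rep M)(q := p)) x"
  proof cases
    case 1
    then show ?thesis using matched_rep_eq[OF inj, of p q] by simp
  next
    case 2
    then obtain p' where "(p', x) \<in> M" by force
    then show ?thesis using 2 matched_rep_eq[OF inj, of p' x] matched_rep_eq[OF inj', of p' x] by simp
  next
    case 3
    then show ?thesis by (simp add: matched_rep_unmatched)
  qed
qed

text \<open>The insertion only relabels \<open>q\<close> as \<open>p\<close>, and before it no other
  class has label \<open>p\<close> or \<open>q\<close>. Hence equality of labels changes only
  between class \<open>p\<close> and class \<open>q\<close>.\<close>

lemma matching_kernel_insert_agree:
  assumes M: "M \<in> matchings L R r" and fin: "finite L" "finite R" and LR: "L \<inter> R = {}"
    and "L \<union> R = {..<k}" and pq: "(p, q) \<in> free_pairs L R M"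
    and "i < m" "j < m" and ne: "{i mod k, j mod k} \<noteq> {p, q}"
  shows "matching_kernel m k (insert (p, q) M) $$ (i, j) = matching_kernel m k M $$ (i, j)"
proof -
  have "p \<in> {..<k}" using pq assms(5) by (auto simp: free_pairs_def)
  then have "i mod k \<in> L \<union> R" "j mod k \<in> L \<union> R" unfolding assms(5) by auto
  moreover have "{x \<in> L \<union> R. matched_rep M x = p} = {p}"
    "{x \<in> L \<union> R. matched_rep M x = q} = {q}"
    using matched_rep_fibre_free[OF M LR, of p] matched_rep_fibre_free[OF M LR, of q] pq
    by (auto simp: free_pairs_def)
  ultimately have rep: "matched_rep M (i mod k) = p \<longleftrightarrow> i mod k = p"
      "matched_rep M (j mod k) = p \<longleftrightarrow> j mod k = p"
      "matched_rep M (i mod k) = q \<longleftrightarrow> i mod k = q"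
      "matched_rep M (j mod k) = q \<longleftrightarrow> j mod k = q"
    by blast+
  have "insert (p, q) M \<in> matchings L R (Suc r)"
    using bij_betw_imp_surj_on[OF bij_betw_insert_free_pair[OF fin, of r]] M pq by force
  moreover have "(p, q) \<notin> M" using pq by (force simp: free_pairs_def)
  ultimately have "matched_rep (insert (p, q) M) = (matched_rep M)(q := p)"
    by (rule matched_rep_insert)
  moreover have "p \<noteq> q" using pq LR by (auto simp: free_pairs_def)
  moreover have "\<not> (i mod k = p \<and> j mod k = q)" "\<not> (i mod k = q \<and> j mod k = p)"
    using ne by auto
  ultimately have "matched_rep (insert (p, q) M) (i mod k) = matched_rep (insert (p, q) M) (j mod k)
      \<longleftrightarrow> matched_rep M (i mod k) = matched_rep M (j mod k)"
    using rep by (metis fun_upd_apply)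
  then show ?thesis
    using assms(7,8) by (simp add: matching_kernel_def cluster_kernel_def)
qed

section \<open>From class sums to suboptimality\<close>

lemma cluster_sum_comp:
  assumes "0 < k"
  shows "cluster_sum m (\<lambda>t. g (t mod k)) a c = (\<Sum>x | x \<in> {..<k} \<and> g x = c. residue_sum m k a x)"
proof -
  have "cluster_sum m (\<lambda>t. g (t mod k)) a c
      = (\<Sum>x\<in>{x \<in> {..<k}. g x = c}. \<Sum>t | t \<in> {t. t < m \<and> g (t mod k) = c} \<and> t mod k = x. a $ t)"
    unfolding cluster_sum_def using assms by (intro sum.group[symmetric]) auto
  also have "\<dots> = (\<Sum>x\<in>{x \<in> {..<k}. g x = c}. residue_sum m k a x)"
    unfolding residue_sum_def cluster_sum_def
    by (intro sum.cong refl arg_cong2[where f = sum]) auto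
  finally show ?thesis by simp
qed

lemma deviation_le_cluster_sums:
  assumes M: "M \<in> matchings L R r" and fin: "finite L" "finite R" and LR: "L \<inter> R = {}"
    and k: "L \<union> R = {..<k}" and k0: "0 < k" and m: "k \<le> m"
  defines "h \<equiv> \<lambda>t. matched_rep M (t mod k)"
  shows "matching_deviation L R M (residue_sum m k a)
    \<le> (\<Sum>c\<in>h ` {..<m}. \<bar>cluster_sum m h a c - 1\<bar>)"
proof -
  let ?S = "residue_sum m k a" and ?\<phi> = "\<lambda>c. \<bar>cluster_sum m h a c - 1\<bar>"
  let ?A = "L - fst ` M" and ?B = "R - snd ` M" and ?C = "fst ` M"
  have sub: "?C \<subseteq> L" and inj: "inj_on fst M" using M by (auto simp: matchings_def)
  have sums: "cluster_sum m h a c = sum ?S {x \<in> L \<union> R. matched_rep M x = c}" for c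
    unfolding h_def k using k0 by (simp add: cluster_sum_comp)
  have free: "?\<phi> c = \<bar>?S c - 1\<bar>" if "c \<in> ?A \<union> ?B" for c
    by (simp only: sums matched_rep_fibre_free[OF M LR that]) simp
  have matched: "?\<phi> p = \<bar>?S p + ?S q - 1\<bar>" if pq: "(p, q) \<in> M" for p q
  proof -
    have "p \<noteq> q" using pq M LR by (auto simp: matchings_def)
    then show ?thesis by (simp only: sums matched_rep_fibre_matched[OF M LR pq]) simp
  qed
  \<comment> \<open>The label \<open>x\<close> really occurs: as \<open>x < k \<le> m\<close>, the
    index \<open>x\<close> has residue \<open>x\<close>.\<close>
  have "x \<in> h ` {..<m}" if x: "x \<in> ?A \<union> ?B \<union> ?C" for x
  proof -
    have "matched_rep M x = x"
      using x sub matched_rep_left[OF M LR] matched_rep_unmatched[of x M] by blast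
    moreover have "x < k" using x sub k by blast
    ultimately have "h x = x" "x < m" using m by (simp_all add: h_def)
    then show ?thesis by (metis imageI lessThan_iff)
  qed
  then have "sum ?\<phi> (?A \<union> ?B \<union> ?C) \<le> sum ?\<phi> (h ` {..<m})"
    by (intro sum_mono2) auto
  moreover have "sum ?\<phi> (?A \<union> ?B \<union> ?C) = sum ?\<phi> ?A + sum ?\<phi> ?B + sum ?\<phi> ?C"
    using LR fin sub finite_matching[OF fin M]
    by (subst sum.union_disjoint; auto)+
  moreover have "sum ?\<phi> ?A = (\<Sum>p\<in>?A. \<bar>?S p - 1\<bar>)" "sum ?\<phi> ?B = (\<Sum>q\<in>?B. \<bar>?S q - 1\<bar>)"
    using free by (auto intro: sum.cong)
  moreover have "sum ?\<phi> ?C = (\<Sum>(p, q)\<in>M. \<bar>?S p + ?S q - 1\<bar>)"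
    unfolding sum.reindex[OF inj] using matched by (intro sum.cong) auto
  ultimately show ?thesis by (simp add: matching_deviation_def)
qed

lemma Delta_matching_kernel_ge:
  assumes M: "M \<in> matchings L R r" and fin: "finite L" "finite R" and LR: "L \<inter> R = {}"
    and k: "L \<union> R = {..<k}" and k0: "0 < k" and m: "k \<le> m"
    and lam: "0 \<le> lam" "4 * lam * real k \<le> 1" and a: "a \<in> carrier_vec m"
  shows "lam * matching_deviation L R M (residue_sum m k a)
    \<le> Delta hinge_loss m a (matching_kernel m k M) lam (vec m (\<lambda>_. 1))"
proof -
  define h where "h = (\<lambda>t. matched_rep M (t mod k))"
  have "lam * matching_deviation L R M (residue_sum m k a)
      \<le> lam * (\<Sum>c\<in>h ` {..<m}. \<bar>cluster_sum m h a c - 1\<bar>)"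
    unfolding h_def using deviation_le_cluster_sums[OF M fin LR k k0 m] lam(1) by (intro mult_left_mono)
  also have "\<dots> \<le> Delta hinge_loss m a (cluster_kernel m h) lam (vec m (\<lambda>_. 1))"
  proof (rule Delta_cluster_kernel_ge[OF a lam(1)])
    fix c assume "c \<in> h ` {..<m}"
    then obtain t where t: "t < m" "c = matched_rep M (t mod k)" by (auto simp: h_def)
    have "t mod k \<in> L \<union> R" unfolding k using k0 by simp
    with t have c: "c < k" "matched_rep M c = c"
      using matched_rep_idem[OF M LR, of "t mod k"] k by auto
    then have "{t. t < m \<and> t mod k = c} \<subseteq> {t. t < m \<and> h t = c}" by (auto simp: h_def)
    then have "m div k \<le> card {t. t < m \<and> h t = c}"
      using le_trans[OF card_residue_class_ge[OF c(1)] card_mono] by simp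
    moreover have "2 * lam * real m \<le> real (m div k)"
    proof -
      \<comment> \<open>Since \<open>m div k\<close> is at least \<open>1\<close>, rounding down
        costs at most a factor \<open>2\<close>; \<open>4 * lam * k \<le> 1\<close> absorbs
        it.\<close>
      have "m < Suc (m div k) * k" using k0 dividend_less_div_times[of k m] by simp
      also have "\<dots> \<le> (2 * (m div k)) * k"
        using m k0 by (intro mult_le_mono1) (simp add: Suc_leI div_greater_zero_iff)
      finally have "real m \<le> 2 * real k * real (m div k)"
        by (metis (mono_tags) less_imp_le mult.assoc mult.commute of_nat_le_iff of_nat_mult of_nat_numeral)
      then have "2 * lam * real m \<le> 2 * lam * (2 * real k * real (m div k))"
        using lam(1) by (intro mult_left_mono) auto
      also have "\<dots> = (4 * lam * real k) * real (m div k)" by simp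
      also have "\<dots> \<le> 1 * real (m div k)" using lam(2) by (intro mult_right_mono) auto
      finally show ?thesis by simp
    qed
    ultimately show "2 * lam * real m \<le> real (card {t. t < m \<and> h t = c})" by linarith
  qed
  finally show ?thesis by (simp add: matching_kernel_def h_def)
qed

section \<open>Budgeted algorithms\<close>

lemma queried_finite: "finite (queried K S)"
  by (induction S) auto

text \<open>The run on \<open>K'\<close> sees the same answers and therefore follows the same branch
  of the adaptive strategy.\<close>

lemma returned_cong:
  assumes "\<And>i j. (i, j) \<in> queried K S \<Longrightarrow> K' $$ (i, j) = K $$ (i, j)"
  shows "returned K' S = returned K S"
  using assms by (induction S) auto

lemma budgeted_matching_deviation:
  fixes A :: "real vec \<Rightarrow> strategy"
  assumes A: "budgeted m B A" and y: "y \<in> carrier_vec m"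
    and fin: "finite L" "finite R" and LR: "L \<inter> R = {}" and k: "L \<union> R = {..<k}"
    and n: "card L = n" "card R = n"
    and LltR: "\<And>p q. p \<in> L \<Longrightarrow> q \<in> R \<Longrightarrow> p \<le> q"
  defines "s \<equiv> \<lambda>M. residue_sum m k (returned (matching_kernel m k M) (A y))"
  shows "real (card (matchings L R r)) * (real (n - r) ^ 2 - real B)
    \<le> real (n - r) * (\<Sum>M\<in>matchings L R r. matching_deviation L R M (s M))
      + (\<Sum>M\<in>matchings L R (Suc r). matching_deviation L R M (s M))"
proof -
  define Q where "Q = (\<lambda>M. queried (matching_kernel m k M) (A y))"
  \<comment> \<open>A query reveals at most one pair of classes. By symmetry the pair is sorted,
    which matches \<open>(p, q)\<close> because left classes do not exceed right ones.\<close>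
  define T where "T = (\<lambda>M. (\<lambda>(i, j). (min (i mod k) (j mod k), max (i mod k) (j mod k))) ` Q M)"
  have K: "kernel_matrix m (matching_kernel m k M)" for M
    by (simp add: matching_kernel_def kernel_matrix_cluster_kernel)
  have Q: "finite (Q M)" "card (Q M) \<le> B" "Q M \<subseteq> {..<m} \<times> {..<m}" for M
    using A K[of M] y by (simp_all add: budgeted_def Q_def queried_finite)
  show ?thesis
  proof (rule matching_deviation_double_counting[OF fin n, where T = T])
    show "finite (T M) \<and> card (T M) \<le> B" for M
      using Q card_image_le[OF Q(1)] order_trans unfolding T_def by blast
  next
    fix M e assume M: "M \<in> matchings L R r" and e: "e \<in> free_pairs L R M - T M"
    obtain p q where pq: "e = (p, q)" by force
    then have "p \<in> L" "q \<in> R" using e by (auto simp: free_pairs_def)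
    then have le: "p \<le> q" by (rule LltR)
    have "returned (matching_kernel m k (insert e M)) (A y) = returned (matching_kernel m k M) (A y)"
    proof (rule returned_cong)
      fix i j assume ij: "(i, j) \<in> queried (matching_kernel m k M) (A y)"
      then have "i < m" "j < m" using Q(3)[of M] by (auto simp: Q_def)
      moreover have "(min (i mod k) (j mod k), max (i mod k) (j mod k)) \<in> T M"
        unfolding T_def using ij by (force simp: Q_def)
      then have "{i mod k, j mod k} \<noteq> {p, q}"
        using e le pq by (auto simp: doubleton_eq_iff min_def max_def split: if_splits)
      ultimately show "matching_kernel m k (insert e M) $$ (i, j) = matching_kernel m k M $$ (i, j)"
        using matching_kernel_insert_agree[OF M fin LR k] e pq by auto
    qed
    then show "s (insert e M) = s M" by (simp add: s_def)
  qed
qed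

section \<open>Averaging over the randomness of the algorithm\<close>

lemma borel_measurable_matching_deviation:
  assumes "\<And>t. t < m \<Longrightarrow> (\<lambda>A. a A $ t) \<in> borel_measurable P"
  shows "(\<lambda>A. matching_deviation L R M (residue_sum m k (a A))) \<in> borel_measurable P"
  unfolding matching_deviation_def residue_sum_def cluster_sum_def case_prod_beta
  using assms by (intro borel_measurable_add borel_measurable_sum borel_measurable_abs
    borel_measurable_diff borel_measurable_const) auto

text \<open>The deterministic double counting is integrated over \<open>P\<close>, so one matching
  is hard for the expected suboptimality. The parameter \<open>q\<close> is both the larger matching
  size and the number of unmatched classes per side in the smaller matching.\<close>

lemma matching_lower_bound:
  assumes P: "randomized_budgeted m B P" and "0 < lam" and q: "0 < q"
    and B: "2 * real B \<le> real q ^ 2" and m: "4 * q \<le> m + 2" and lam_q: "16 * lam * real q \<le> 1"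
  obtains K where "kernel_matrix m K"
    "ennreal (lam * real q / 8) \<le> expected_Delta hinge_loss m P K lam (vec m (\<lambda>_. 1))"
proof -
  \<comment> \<open>With these sizes \<open>n - r = Suc r = q\<close>, so there are \<open>q\<close>
    times as many matchings of size \<open>q\<close> as of size \<open>r\<close>, and both sums in
    the double counting carry the same weight.\<close>
  define n r k where "n = 2 * q - 1" and "r = q - 1" and "k = 2 * n"
  define L R where "L = {..<n}" and "R = {n..<k}"
  define y :: "real vec" where "y = vec m (\<lambda>_. 1)"
  \<comment> \<open>If every expectation of \<open>F\<close> were at most \<open>b\<close>, the
    right-hand side would be at most \<open>lam * q\<^sup>2 / 4\<close> per smaller matching, while
    \<open>2 * B \<le> q\<^sup>2\<close> makes the left at least
    \<open>lam * q\<^sup>2 / 2\<close>.\<close>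
  define b where "b = lam * real q / 8"
  define K where "K = matching_kernel m k"
  \<comment> \<open>A measurable minorant of the suboptimality; passing from it to
    \<open>Delta\<close> inside the nonnegative integral needs only monotonicity.\<close>
  define F where "F = (\<lambda>M A. lam * matching_deviation L R M (residue_sum m k (returned (K M) (A y))))"
  have fin: "finite L" "finite R" and n: "card L = n" "card R = n" and LR: "L \<inter> R = {}"
    and k: "L \<union> R = {..<k}" and le: "\<And>p q. p \<in> L \<Longrightarrow> q \<in> R \<Longrightarrow> p \<le> q"
    by (auto simp: L_def R_def k_def)
  have nr: "n - r = q" "Suc r = q" and km: "k \<le> m" and k0: "0 < k"
    using q m by (simp_all add: n_def r_def k_def)
  have lam_k: "4 * lam * real k \<le> 1"
  proof -
    have "real k \<le> 4 * real q" by (simp add: k_def n_def)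
    then have "4 * lam * real k \<le> 4 * lam * (4 * real q)"
      using \<open>0 < lam\<close> by (intro mult_left_mono) auto
    with lam_q show ?thesis by simp
  qed
  interpret prob_space P using P by (simp add: randomized_budgeted_def)
  have KM: "kernel_matrix m (K M)" for M
    by (simp add: K_def matching_kernel_def kernel_matrix_cluster_kernel)
  have y: "y \<in> carrier_vec m" by (simp add: y_def)
  have bud: "budgeted m B A" if "A \<in> space P" for A using P that by (simp add: randomized_budgeted_def)
  have F_nonneg: "0 \<le> F M A" for M A
    unfolding F_def matching_deviation_def using \<open>0 < lam\<close>
    by (intro mult_nonneg_nonneg add_nonneg_nonneg sum_nonneg) auto
  have F_meas: "F M \<in> borel_measurable P" for M
    unfolding F_def using P KM[of M] y
    by (intro borel_measurable_times borel_measurable_const borel_measurable_matching_deviation)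
       (auto simp: randomized_budgeted_def)
  have F_le: "F M A \<le> Delta hinge_loss m (returned (K M) (A y)) (K M) lam y"
    if "M \<in> matchings L R j" "A \<in> space P" for M A j
    unfolding F_def K_def y_def
    using Delta_matching_kernel_ge[OF that(1) fin LR k k0 km _ lam_k] bud[OF that(2)] \<open>0 < lam\<close> y KM[of M]
    by (simp add: budgeted_def K_def y_def)
  have "\<exists>M j. M \<in> matchings L R j \<and> ennreal b \<le> (\<integral>\<^sup>+ A. ennreal (F M A) \<partial>P)"
  proof (rule ccontr)
    assume neg: "\<not> ?thesis"
    have small: "(\<integral>\<^sup>+ A. ennreal (F M A) \<partial>P) < ennreal b" if "M \<in> matchings L R j" for M j
      using neg that by (meson not_le)
    \<comment> \<open>The assumed upper bound makes the integral finite, so real-valued integrals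
      may be used in the contradiction.\<close>
    have int: "integrable P (F M)" if "M \<in> matchings L R j" for M j
      using small[OF that] F_meas F_nonneg
      by (intro integrableI_nonneg) (auto intro: order.strict_trans)
    have F_int: "(\<integral>A. F M A \<partial>P) \<le> b" if "M \<in> matchings L R j" for M j
      using less_imp_le[OF small[OF that]] nn_integral_eq_integral[OF int[OF that]] F_nonneg
        \<open>0 < lam\<close>
      by (simp add: b_def)
    let ?N = "real (card (matchings L R r))"
    have "?N * (real q ^ 2 - real B) * lam
        = (\<integral>A. ?N * (real q ^ 2 - real B) * lam \<partial>P)"
      by (simp add: prob_space)
    also have "\<dots> \<le> (\<integral>A. real q * (\<Sum>M\<in>matchings L R r. F M A) + (\<Sum>M\<in>matchings L R q. F M A) \<partial>P)"
    proof (intro integral_mono integrable_const Bochner_Integration.integrable_add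
        integrable_mult_right Bochner_Integration.integrable_sum int)
      fix A assume "A \<in> space P"
      from mult_right_mono[OF budgeted_matching_deviation[OF bud[OF this] y fin LR k n le, where r = r], of lam]
      show "?N * (real q ^ 2 - real B) * lam
          \<le> real q * (\<Sum>M\<in>matchings L R r. F M A) + (\<Sum>M\<in>matchings L R q. F M A)"
        using \<open>0 < lam\<close> unfolding nr F_def K_def
        by (simp add: sum_distrib_left[symmetric] distrib_left distrib_right mult.commute mult.left_commute)
    qed auto
    also have "\<dots> = real q * (\<Sum>M\<in>matchings L R r. \<integral>A. F M A \<partial>P) + (\<Sum>M\<in>matchings L R q. \<integral>A. F M A \<partial>P)"
      using int by (simp add: Bochner_Integration.integral_add Bochner_Integration.integral_sum)
    also have "\<dots> \<le> real q * (\<Sum>M\<in>matchings L R r. b) + (\<Sum>M\<in>matchings L R q. b)"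
      by (intro add_mono mult_left_mono sum_mono F_int) auto
    also have "\<dots> = 2 * ?N * real q * b"
    proof -
      have "card (matchings L R q) * q = card (matchings L R r) * q * q"
        using card_matchings_Suc[OF fin, of r] n nr by simp
      then have "card (matchings L R q) = card (matchings L R r) * q" using q by simp
      then show ?thesis by simp
    qed
    also have "\<dots> = ?N * (real q ^ 2 / 4) * lam" by (simp add: b_def power2_eq_square)
    finally have "?N * lam * (real q ^ 2 - real B) \<le> ?N * lam * (real q ^ 2 / 4)" by (simp add: mult_ac)
    moreover have "0 < ?N"
      using matchings_nonempty[OF fin, of r] n nr finite_matchings[OF fin, of r]
      by (simp add: card_gt_0_iff)
    ultimately have "real q ^ 2 - real B \<le> real q ^ 2 / 4" using \<open>0 < lam\<close> by simp
    moreover have "0 < real q ^ 2" using q by simp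
    ultimately show False using B by linarith
  qed
  then obtain M j where M: "M \<in> matchings L R j" and "ennreal b \<le> (\<integral>\<^sup>+ A. ennreal (F M A) \<partial>P)"
    by blast
  note this(2)
  also have "(\<integral>\<^sup>+ A. ennreal (F M A) \<partial>P) \<le> expected_Delta hinge_loss m P (K M) lam y"
    unfolding expected_Delta_def using F_le[OF M] by (intro nn_integral_mono ennreal_leI)
  finally show ?thesis using that[OF KM] by (simp add: b_def y_def)
qed

theorem corollary3:
  shows "\<exists>c c' c'' :: real. 0 < c \<and> 0 < c' \<and> 0 < c'' \<and>
    (\<forall>(lam :: real) (m :: nat) (B :: nat).
       0 < lam \<and> lam \<le> 1 / 4 \<and> 0 < m \<and> 0 < B \<and>
       real B < c / lam ^ 2 \<and> c / lam ^ 2 \<le> c' * real m ^ 2 \<longrightarrow>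
       (\<forall>P. randomized_budgeted m B P \<longrightarrow>
          (\<exists>K y. kernel_matrix m K \<and>
             y \<in> carrier_vec m \<and> (\<forall>t<m. y $ t \<in> {-1, 1}) \<and>
             ennreal c'' \<le> expected_Delta hinge_loss m P K lam y)))"
proof (rule exI[of _ "1 / 2048"], rule exI[of _ "1 / 128"], rule exI[of _ "1 / 256"],
    intro conjI allI impI; (elim conjE)?)
  fix lam :: real and m B :: nat and P
  assume lam: "0 < lam" and "0 < m" "0 < B" and Bc: "real B < 1 / 2048 / lam ^ 2"
    and c: "1 / 2048 / lam ^ 2 \<le> 1 / 128 * real m ^ 2" and P: "randomized_budgeted m B P"
  \<comment> \<open>The largest \<open>q\<close> with \<open>16 * lam * q \<le> 1\<close>. Once
    \<open>q\<close> is at least \<open>1 / (32 * lam)\<close>, the constant \<open>1 / 2048\<close>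
    gives \<open>2 * B \<le> q\<^sup>2\<close> and \<open>1 / 256\<close> is \<open>1 / 32\<close>
    times the \<open>1 / 8\<close> in the bound; \<open>1 / 128\<close> turns into
    \<open>1 / (4 * lam) \<le> m\<close>.\<close>
  define q where "q = nat \<lfloor>1 / (16 * lam)\<rfloor>"
  \<comment> \<open>A positive budget below the threshold forces \<open>lam\<close> to be small, so
    that rounding \<open>1 / (16 * lam)\<close> down loses at most half of it.\<close>
  have "1 < 1 / 2048 / lam ^ 2" using Bc \<open>0 < B\<close> by linarith
  then have "(32 * lam)\<^sup>2 \<le> 1\<^sup>2" using lam by (simp add: power2_eq_square divide_simps)
  then have lam32: "32 * lam \<le> 1" using power2_le_imp_le[of "32 * lam" 1] by simp
  have q_le: "real q \<le> 1 / (16 * lam)" using lam by (simp add: q_def)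
  have "1 / (16 * lam) < real q + 1" using lam by (simp add: q_def)
  moreover have "1 \<le> 1 / (32 * lam)" using lam lam32 by simp
  moreover have "1 / (16 * lam) = 1 / (32 * lam) + 1 / (32 * lam)" by simp
  ultimately have q_ge: "1 / (32 * lam) \<le> real q" by linarith
  with \<open>1 \<le> 1 / (32 * lam)\<close> have "1 \<le> real q" by linarith
  then have "0 < q" by simp
  have "2 * real B \<le> (1 / (32 * lam))\<^sup>2"
    using Bc by (simp add: power2_eq_square)
  also have "\<dots> \<le> real q ^ 2" using q_ge lam by (intro power_mono) auto
  finally have "2 * real B \<le> real q ^ 2" .
  moreover have "4 * q \<le> m + 2"
  proof -
    have "(1 / (4 * lam))\<^sup>2 \<le> real m ^ 2" using c by (simp add: power2_eq_square)
    then have "1 / (4 * lam) \<le> real m" by (rule power2_le_imp_le) simp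
    with q_le have "real (4 * q) \<le> real m" by simp
    then show ?thesis by linarith
  qed
  moreover have "16 * lam * real q \<le> 1" using q_le lam by (simp add: field_simps)
  ultimately obtain K where K: "kernel_matrix m K"
    "ennreal (lam * real q / 8) \<le> expected_Delta hinge_loss m P K lam (vec m (\<lambda>_. 1))"
    using matching_lower_bound[OF P lam \<open>0 < q\<close>] by blast
  have "1 / 256 \<le> lam * real q / 8" using q_ge lam by (simp add: field_simps)
  then have "ennreal (1 / 256) \<le> expected_Delta hinge_loss m P K lam (vec m (\<lambda>_. 1))"
    using K(2) ennreal_leI order_trans by blast
  with K(1) show "\<exists>K y. kernel_matrix m K \<and> y \<in> carrier_vec m \<and> (\<forall>t<m. y $ t \<in> {-1, 1}) \<and>
      ennreal (1 / 256) \<le> expected_Delta hinge_loss m P K lam y"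
    by (intro exI[of _ K] exI[of _ "vec m (\<lambda>_. 1)"]) auto
qed simp_all

end
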